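(* For every connected graph $G$, $$\alpha_b(G)\leq 4\alpha(G).$$
   Context: All graphs are finite, simple, undirected, and nonempty. $\mathbb{N}_0$ is the set of nonnegative integers, $\mathrm{dist}_G$ denotes distance in $G$, $\mathrm{ecc}_G(x)$ the eccentricity of $x$ in $G$, and $\alpha(G)$ the independence number of $G$ (maximum cardinality of a set of pairwise nonadjacent vertices). For a connected graph $G$, a function $f:V(G)\to\mathbb{N}_0$ is an independent broadcast on $G$ if (B1) $f(x)\leq \mathrm{ecc}_G(x)$ for every vertex $x$ of $G$, and (B2) $\mathrm{dist}_G(x,y)>\max\{f(x),f(y)\}$ for every two distinct vertices $x,y$ of $G$ with $f(x),f(y)>0$. The weight of $f$ is $\sum_{x\in V(G)}f(x)$. The broadcast independence number $\alpha_b(G)$ is the maximum weight of an independent broadcast on $G$. *)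

theory Defs
  imports "Graph_Theory.Graph_Theory"
begin

text \<open>
  A finite simple undirected graph is a \<^locale>\<open>graph\<close>, i.e. a finite symmetric digraph without
  loops and parallel arcs: each edge is represented by its two opposite arcs. Nonemptiness of the
  vertex set is part of \<^const>\<open>connected\<close>.

  The definitions below are meant for connected graphs (and vertices of them); only there are the
  minima and maxima guaranteed to be taken over nonempty (and finite) sets.
\<close>

definition graph_dist :: "('a, 'b) pre_digraph \<Rightarrow> 'a \<Rightarrow> 'a \<Rightarrow> nat" where
  "graph_dist G x y = (LEAST n. \<exists>p. pre_digraph.apath G x p y \<and> length p = n)"

definition ecc :: "('a, 'b) pre_digraph \<Rightarrow> 'a \<Rightarrow> nat" where
  "ecc G x = Max (graph_dist G x ` verts G)"

definition independent_set :: "('a, 'b) pre_digraph \<Rightarrow> 'a set \<Rightarrow> bool" where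
  "independent_set G S \<longleftrightarrow> S \<subseteq> verts G \<and> (\<forall>x\<in>S. \<forall>y\<in>S. x \<noteq> y \<longrightarrow> \<not> x \<rightarrow>\<^bsub>G\<^esub> y)"

definition independence_number :: "('a, 'b) pre_digraph \<Rightarrow> nat" where
  "independence_number G = Max (card ` {S. independent_set G S})"

text \<open>Values of a broadcast outside the vertex set are irrelevant.\<close>

definition independent_broadcast :: "('a, 'b) pre_digraph \<Rightarrow> ('a \<Rightarrow> nat) \<Rightarrow> bool" where
  "independent_broadcast G f \<longleftrightarrow>
     (\<forall>x\<in>verts G. f x \<le> ecc G x) \<and>
     (\<forall>x\<in>verts G. \<forall>y\<in>verts G. x \<noteq> y \<longrightarrow> f x > 0 \<longrightarrow> f y > 0 \<longrightarrow>
        graph_dist G x y > max (f x) (f y))"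

definition broadcast_weight :: "('a, 'b) pre_digraph \<Rightarrow> ('a \<Rightarrow> nat) \<Rightarrow> nat" where
  "broadcast_weight G f = (\<Sum>x\<in>verts G. f x)"

definition broadcast_independence_number :: "('a, 'b) pre_digraph \<Rightarrow> nat" where
  "broadcast_independence_number G = Max (broadcast_weight G ` {f. independent_broadcast G f})"

lemma (in fin_digraph) graph_dist_eq_mu:
  assumes "x \<rightarrow>\<^sup>*\<^bsub>G\<^esub> y"
  shows "ereal (real (graph_dist G x y)) = \<mu> (\<lambda>_. 1) x y"
proof -
  have cost: "awalk_cost (\<lambda>_. 1) p = real (length p)" for p :: "'b list"
    by (induction p) auto
  obtain p where p: "apath x p y" "\<mu> (\<lambda>_. 1) x y = awalk_cost (\<lambda>_. 1) p"
    using min_cost_awalk[OF assms, of "\<lambda>_. 1"] by auto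
  have "length p \<le> length q" if "apath x q y" for q
  proof -
    have "\<mu> (\<lambda>_. 1) x y \<le> awalk_cost (\<lambda>_. 1) q"
      using that by (intro min_cost_le_walk_cost) (auto simp: apath_def)
    then show ?thesis by (simp add: p(2) cost)
  qed
  then have "graph_dist G x y = length p"
    unfolding graph_dist_def by (intro Least_equality) (use p(1) in auto)
  then show ?thesis by (simp add: p(2) cost)
qed

lemma finite_card_independent_sets:
  assumes "finite (verts G)"
  shows "finite (card ` {S. independent_set G S})" "card ` {S. independent_set G S} \<noteq> {}"
proof -
  have "{S. independent_set G S} \<subseteq> Pow (verts G)" by (auto simp: independent_set_def)
  then show "finite (card ` {S. independent_set G S})"
    using assms by (intro finite_imageI) (auto intro: finite_subset)
  have "independent_set G {}" by (simp add: independent_set_def)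
  then show "card ` {S. independent_set G S} \<noteq> {}" by auto
qed

lemma finite_broadcast_weights:
  shows "finite (broadcast_weight G ` {f. independent_broadcast G f})"
    "broadcast_weight G ` {f. independent_broadcast G f} \<noteq> {}"
proof -
  have "broadcast_weight G ` {f. independent_broadcast G f} \<subseteq> {..\<Sum>x\<in>verts G. ecc G x}"
    by (auto simp: independent_broadcast_def broadcast_weight_def intro: sum_mono)
  then show "finite (broadcast_weight G ` {f. independent_broadcast G f})"
    by (rule finite_subset) simp
  have "independent_broadcast G (\<lambda>_. 0)" by (simp add: independent_broadcast_def)
  then show "broadcast_weight G ` {f. independent_broadcast G f} \<noteq> {}" by auto
qed

end

theory Submission
  imports Defs
begin

text \<open>
  Let \<open>f\<close> be an independent broadcast. Around each vertex \<open>x\<close> with \<open>f x > 0\<close> consider the ball of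
  radius \<open>r x = (f x - 1) div 2\<close>. Since \<open>r x + r y \<le> max (f x) (f y) - 1\<close>, two such balls have
  distance at least 2, so independent sets chosen inside distinct balls have an independent
  union. As \<open>r x \<le> ecc x\<close>, the ball around \<open>x\<close> contains vertices at distances \<open>0, 2, 4, \<dots>\<close> from
  \<open>x\<close>, up to \<open>r x\<close>; they are \<open>r x div 2 + 1 \<ge> f x / 4\<close> many and pairwise nonadjacent.
\<close>

section \<open>Distance as the length of a shortest walk\<close>

context wf_digraph
begin

text \<open>\<open>graph_dist\<close> minimises over paths, but concatenation and reversal produce
  walks. A walk shortens to a path whose arcs are distinct and all occur in the walk, so counting
  arcs gives the bound.\<close>

lemma graph_dist_le_awalk:
  assumes "awalk x p y"
  shows "graph_dist G x y \<le> length p"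
proof -
  let ?q = "awalk_to_apath p"
  have q: "apath x ?q y"
    using assms by (rule apath_awalk_to_apath)
  then have "distinct ?q"
    by (auto simp: apath_def intro: distinct_verts_imp_distinct)
  then have "length ?q = card (set ?q)"
    by (simp add: distinct_card)
  also have "\<dots> \<le> card (set p)"
    using awalk_to_apath_subset[OF assms] by (intro card_mono) auto
  also have "\<dots> \<le> length p"
    by (rule card_length)
  finally have "length ?q \<le> length p" .
  moreover have "graph_dist G x y \<le> length ?q"
    unfolding graph_dist_def using q by (intro Least_le) auto
  ultimately show ?thesis by simp
qed

lemma shortest_awalkE:
  assumes "x \<rightarrow>\<^sup>* y"
  obtains p where "awalk x p y" "length p = graph_dist G x y"
proof -
  have "\<exists>n p. apath x p y \<and> length p = n"
    using assms apath_awalk_to_apath by (auto simp: reachable_awalk)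
  then have "\<exists>p. apath x p y \<and> length p = graph_dist G x y"
    unfolding graph_dist_def by (rule LeastI_ex)
  then show thesis
    using that awalkI_apath by blast
qed

lemma graph_dist_self:
  assumes "x \<in> verts G"
  shows "graph_dist G x x = 0"
  using graph_dist_le_awalk[of x "[]" x] assms by (simp add: awalk_Nil_iff)

lemma graph_dist_adj_le:
  assumes "x \<rightarrow>\<^bsub>G\<^esub> y"
  shows "graph_dist G x y \<le> 1"
proof -
  obtain e where "e \<in> arcs G" "tail G e = x" "head G e = y"
    using assms by (auto simp: arcs_ends_conv)
  then show ?thesis
    using graph_dist_le_awalk[of x "[e]" y] arc_implies_awalk by fastforce
qed

lemma graph_dist_triangle:
  assumes "x \<rightarrow>\<^sup>* y" "y \<rightarrow>\<^sup>* z"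
  shows "graph_dist G x z \<le> graph_dist G x y + graph_dist G y z"
proof -
  obtain p where p: "awalk x p y" "length p = graph_dist G x y"
    using assms(1) by (rule shortest_awalkE)
  obtain q where q: "awalk y q z" "length q = graph_dist G y z"
    using assms(2) by (rule shortest_awalkE)
  show ?thesis
    using graph_dist_le_awalk[OF awalk_appendI[OF p(1) q(1)]] p(2) q(2) by simp
qed

text \<open>The vertex reached after \<open>k\<close> arcs of a shortest walk works: the two pieces
  have lengths \<open>k\<close> and \<open>graph_dist G x y - k\<close>, so the triangle inequality
  leaves no slack in either.\<close>

lemma ex_vertex_at_graph_dist:
  assumes "x \<rightarrow>\<^sup>* y" "k \<le> graph_dist G x y"
  shows "\<exists>v\<in>verts G. graph_dist G x v = k"
proof -
  obtain p where p: "awalk x p y" "length p = graph_dist G x y"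
    using assms(1) by (rule shortest_awalkE)
  define v where "v = awlast x (take k p)"
  have "awalk x (take k p @ drop k p) y"
    using p(1) by simp
  then have walks: "awalk x (take k p) v" "awalk v (drop k p) y"
    unfolding v_def by (simp_all only: awalk_append_iff)
  have "graph_dist G x y \<le> graph_dist G x v + graph_dist G v y"
    using walks by (intro graph_dist_triangle reachable_awalkI)
  moreover have "graph_dist G x v \<le> k" "graph_dist G v y \<le> graph_dist G x y - k"
    using walks[THEN graph_dist_le_awalk] p(2) by auto
  ultimately have "graph_dist G x v = k"
    using assms(2) by linarith
  then show ?thesis
    using walks(1) awalk_last_in_verts by blast
qed

end

section \<open>Symmetry of the distance\<close>

context sym_digraph
begin

lemma connected_imp_reachable:
  assumes "connected G" "u \<in> verts G" "v \<in> verts G"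
  shows "u \<rightarrow>\<^sup>* v"
  using symmetric_connected_imp_strongly_connected[OF sym_arcs assms(1)] assms(2,3)
  by (auto simp: strongly_connected_def)

lemma awalk_revE:
  assumes "awalk x p y"
  obtains q where "awalk y q x" "length q = length p"
proof -
  have "\<exists>q. awalk y q x \<and> length q = length p"
    using assms
  proof (induction p arbitrary: x)
    case Nil
    then show ?case by (auto simp: awalk_Nil_iff)
  next
    case (Cons e p)
    then obtain q where q: "awalk y q (head G e)" "length q = length p"
      by (auto simp: awalk_Cons_iff)
    have e: "e \<in> arcs G" "tail G e = x"
      using Cons.prems by (auto simp: awalk_Cons_iff)
    \<comment> \<open>An edge is a pair of opposite arcs, so the reversed walk runs through the
      opposite arcs, not through the list \<open>p\<close> reversed.\<close>
    then obtain e' where "e' \<in> arcs G" "tail G e' = head G e" "head G e' = x"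
      using sym_arcs unfolding symmetric_conv by metis
    then have "awalk y (q @ [e']) x"
      using q(1) arc_implies_awalk awalk_appendI by metis
    then show ?case
      using q(2) by (metis length_append_singleton length_Cons)
  qed
  then show thesis using that by blast
qed

lemma graph_dist_sym:
  assumes "x \<rightarrow>\<^sup>* y"
  shows "graph_dist G x y = graph_dist G y x"
proof -
  have "graph_dist G v u \<le> graph_dist G u v" if "u \<rightarrow>\<^sup>* v" for u v
    using that by (metis shortest_awalkE awalk_revE graph_dist_le_awalk)
  then show ?thesis
    using assms symmetric_reachable' by (meson antisym)
qed

end

section \<open>Independent sets inside balls and the bound\<close>

context graph
begin

lemma ex_graph_dist_eq_ecc:
  assumes "x \<in> verts G"
  shows "\<exists>y\<in>verts G. graph_dist G x y = ecc G x"
proof -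
  have "ecc G x \<in> graph_dist G x ` verts G"
    unfolding ecc_def using assms by (intro Max_in) auto
  then show ?thesis by auto
qed

text \<open>Take one vertex on each even distance level around \<open>x\<close> up to
  \<open>r\<close>. By the triangle inequality, vertices on levels \<open>2 * i\<close> and
  \<open>2 * j\<close> are at least the difference of the levels apart.\<close>

lemma ex_spread_set_in_ball:
  assumes "connected G" "x \<in> verts G" "r \<le> ecc G x"
  shows "\<exists>S\<subseteq>verts G. card S = r div 2 + 1 \<and> (\<forall>u\<in>S. graph_dist G x u \<le> r) \<and>
    (\<forall>u\<in>S. \<forall>v\<in>S. u \<noteq> v \<longrightarrow> graph_dist G u v \<ge> 2)"
proof -
  note reach = connected_imp_reachable[OF assms(1)]
  \<comment> \<open>A shortest walk to a vertex at distance \<open>ecc G x\<close> meets every level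
    up to \<open>r\<close>.\<close>
  have "\<exists>v\<in>verts G. graph_dist G x v = k" if "k \<le> r" for k
    using ex_graph_dist_eq_ecc[OF assms(2)] ex_vertex_at_graph_dist reach assms(2,3) that
    by (metis le_trans)
  then obtain w where w: "\<And>k. k \<le> r \<Longrightarrow> w k \<in> verts G" "\<And>k. k \<le> r \<Longrightarrow> graph_dist G x (w k) = k"
    by metis
  let ?S = "(\<lambda>i. w (2 * i)) ` {..r div 2}"
  have "2 * i \<le> r" if "i \<le> r div 2" for i
    using that by linarith
  note w' = w(1)[OF this] w(2)[OF this]
  \<comment> \<open>The distance from \<open>x\<close> recovers the index.\<close>
  have "inj_on (\<lambda>i. w (2 * i)) {..r div 2}"
  proof (rule inj_onI)
    fix i j assume "i \<in> {..r div 2}" "j \<in> {..r div 2}" "w (2 * i) = w (2 * j)"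
    then have "2 * i = 2 * j"
      using w'(2) by (metis atMost_iff)
    then show "i = j" by simp
  qed
  then have "card ?S = r div 2 + 1"
    by (simp add: card_image)
  moreover have "graph_dist G u v \<ge> 2" if "u \<in> ?S" "v \<in> ?S" "u \<noteq> v" for u v
  proof -
    obtain i j where ij: "u = w (2 * i)" "v = w (2 * j)" "i \<le> r div 2" "j \<le> r div 2" "i \<noteq> j"
      using \<open>u \<in> ?S\<close> \<open>v \<in> ?S\<close> \<open>u \<noteq> v\<close> by auto
    then have uv: "u \<in> verts G" "v \<in> verts G" "graph_dist G x u = 2 * i" "graph_dist G x v = 2 * j"
      using w' by auto
    then have "2 * j \<le> 2 * i + graph_dist G u v" "2 * i \<le> 2 * j + graph_dist G u v"
      using graph_dist_triangle[OF reach reach, of x u v] graph_dist_triangle[OF reach reach, of x v u]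
        graph_dist_sym[OF reach, of u v] assms(2) by auto
    then show ?thesis
      using \<open>i \<noteq> j\<close> by linarith
  qed
  moreover have "?S \<subseteq> verts G" "\<forall>u\<in>?S. graph_dist G x u \<le> r"
    using w' by auto
  ultimately show ?thesis by blast
qed

lemma card_le_independence_number:
  assumes "independent_set G S"
  shows "card S \<le> independence_number G"
  unfolding independence_number_def
  using assms finite_card_independent_sets(1)[OF finite_verts] by (intro Max_ge) auto

lemma broadcast_weight_le:
  assumes "connected G" "independent_broadcast G f"
  shows "broadcast_weight G f \<le> 4 * independence_number G"
proof -
  note reach = connected_imp_reachable[OF assms(1)]
  define X where "X = {x \<in> verts G. f x > 0}"
  define r where "r x = (f x - 1) div 2" for x
  have "r x \<le> ecc G x" if "x \<in> X" for x
  proof -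
    have "f x \<le> ecc G x"
      using assms(2) that by (auto simp: independent_broadcast_def X_def)
    then show ?thesis unfolding r_def by linarith
  qed
  then have "\<forall>x\<in>X. \<exists>S\<subseteq>verts G. card S = r x div 2 + 1 \<and> (\<forall>u\<in>S. graph_dist G x u \<le> r x) \<and>
      (\<forall>u\<in>S. \<forall>v\<in>S. u \<noteq> v \<longrightarrow> graph_dist G u v \<ge> 2)"
    using ex_spread_set_in_ball[OF assms(1)] by (simp add: X_def)
  then obtain S where S:
    "\<And>x. x \<in> X \<Longrightarrow> S x \<subseteq> verts G"
    "\<And>x. x \<in> X \<Longrightarrow> card (S x) = r x div 2 + 1"
    "\<And>x u. x \<in> X \<Longrightarrow> u \<in> S x \<Longrightarrow> graph_dist G x u \<le> r x"
    "\<And>x u v. x \<in> X \<Longrightarrow> u \<in> S x \<Longrightarrow> v \<in> S x \<Longrightarrow> u \<noteq> v \<Longrightarrow> graph_dist G u v \<ge> 2"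
    by metis
  \<comment> \<open>The case \<open>u = v\<close> is deliberately included: distance 0 would violate
    the bound, so the sets \<open>S x\<close> are also pairwise disjoint.\<close>
  have apart: "graph_dist G u v \<ge> 2" if "x \<in> X" "y \<in> X" "x \<noteq> y" "u \<in> S x" "v \<in> S y" for x y u v
  proof -
    have verts: "x \<in> verts G" "y \<in> verts G" "u \<in> verts G" "v \<in> verts G"
      using that S(1) by (auto simp: X_def)
    have pos: "f x > 0" "f y > 0"
      using that by (auto simp: X_def)
    have "max (f x) (f y) < graph_dist G x y"
      using assms(2) verts pos \<open>x \<noteq> y\<close> by (auto simp: independent_broadcast_def)
    also have "\<dots> \<le> graph_dist G x u + graph_dist G u y"
      using verts by (intro graph_dist_triangle reach)
    also have "\<dots> \<le> graph_dist G x u + (graph_dist G u v + graph_dist G v y)"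
      using verts by (intro add_left_mono graph_dist_triangle reach)
    also have "\<dots> \<le> r x + (graph_dist G u v + r y)"
      using S(3)[of x u] S(3)[of y v] that graph_dist_sym[OF reach[OF verts(2,4)]] by simp
    \<comment> \<open>Since \<open>f x\<close> and \<open>f y\<close> are positive,
      \<open>r x + r y\<close> is at most \<open>max (f x) (f y) - 1\<close>, while the chain is
      strict; a gap of at least 2 remains for \<open>graph_dist G u v\<close>.\<close>
    finally show ?thesis
      using pos unfolding r_def by linarith
  qed
  define T where "T = (\<Union>x\<in>X. S x)"
  have "finite X"
    by (simp add: X_def)
  have "graph_dist G u v \<ge> 2" if "u \<in> T" "v \<in> T" "u \<noteq> v" for u v
    using that S(4) apart unfolding T_def by blast
  then have "\<not> u \<rightarrow>\<^bsub>G\<^esub> v" if "u \<in> T" "v \<in> T" "u \<noteq> v" for u v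
    using graph_dist_adj_le[of u v] that by fastforce
  moreover have "T \<subseteq> verts G"
    unfolding T_def using S(1) by (rule UN_least)
  ultimately have "independent_set G T"
    by (simp add: independent_set_def)
  then have "card T \<le> independence_number G"
    by (rule card_le_independence_number)
  moreover have "card T = (\<Sum>x\<in>X. card (S x))"
    unfolding T_def
  proof (rule card_UN_disjoint[OF \<open>finite X\<close>])
    show "\<forall>x\<in>X. finite (S x)"
      using S(1) finite_subset[OF _ finite_verts] by blast
    have False if "x \<in> X" "y \<in> X" "x \<noteq> y" "u \<in> S x" "u \<in> S y" for x y u
      using apart[OF that] graph_dist_self[of u] S(1) that by auto
    then show "\<forall>x\<in>X. \<forall>y\<in>X. x \<noteq> y \<longrightarrow> S x \<inter> S y = {}"
      by blast
  qed
  \<comment> \<open>Vertices outside \<open>X\<close> have value 0.\<close>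
  moreover have "broadcast_weight G f = (\<Sum>x\<in>X. f x)"
    unfolding broadcast_weight_def X_def by (intro sum.mono_neutral_right) auto
  moreover have "(\<Sum>x\<in>X. f x) \<le> (\<Sum>x\<in>X. 4 * card (S x))"
  proof (rule sum_mono)
    fix x assume "x \<in> X"
    \<comment> \<open>The two halvings amount to \<open>(n - 1) div 4\<close>, and adding 1 makes
      this \<open>n / 4\<close> rounded up for positive \<open>n\<close>; this is the source of the
      factor 4.\<close>
    have "n \<le> 4 * ((n - 1) div 2 div 2 + 1)" for n :: nat
      by presburger
    then show "f x \<le> 4 * card (S x)"
      unfolding S(2)[OF \<open>x \<in> X\<close>] r_def .
  qed
  ultimately show ?thesis
    by (simp add: sum_distrib_left[symmetric])
qed

end

theorem mainTheorem2:
  fixes G :: "('a, 'b) pre_digraph"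
  assumes "graph G" and "connected G"
  shows "broadcast_independence_number G \<le> 4 * independence_number G"
  unfolding broadcast_independence_number_def
  using finite_broadcast_weights[of G] graph.broadcast_weight_le[OF assms]
  by (subst Max_le_iff) auto

end
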